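(* Let $n\ge 2$, let $\Phi:[0,1]_{\mathbb D}\to\mathbb D^{+}$ be an admissible hyperbolic generator, and let $\mathcal N_\Phi:\mathcal P_{\mathbb D}(n)\to\mathcal P_{\mathbb D}(n)$ be the hyperbolic negator generated by $\Phi$. Suppose that, for every $P=(p_1,\ldots,p_n)\in\mathcal P_{\mathbb D}(n)$, every active idempotent component $\ell\in\{1,2\}$ of $P$, and all $i,j\in\{1,\ldots,n\}$, \[ p_j^{(\ell)}=1\ \Longrightarrow\ \Phi^{(\ell)}(p_j)=0, \] and \[ p_i^{(\ell)}\le p_j^{(\ell)}<1\ \Longrightarrow\ \Phi^{(\ell)}(p_i)\ge\Phi^{(\ell)}(p_j)\ \text{ and }\ \frac{\Phi^{(\ell)}(p_i)}{1-p_i^{(\ell)}}\le\frac{\Phi^{(\ell)}(p_j)}{1-p_j^{(\ell)}}. \] Then, for every $P\in\mathcal P_{\mathbb D}(n)$, $H_{\mathbb D}(P)\preceq_{\mathbb D}H_{\mathbb D}(\mathcal N_\Phi(P))$ and $G_{\mathbb D}(P)\preceq_{\mathbb D}G_{\mathbb D}(\mathcal N_\Phi(P))$.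
   Context: Hyperbolic numbers: $\mathbb D=\{a+\mathbf k b: a,b\in\mathbb R\}$ with $\mathbf k^2=1$, $\mathbf e_1=(1+\mathbf k)/2$, $\mathbf e_2=(1-\mathbf k)/2$. Every $z\in\mathbb D$ is uniquely $z=z^{(1)}\mathbf e_1+z^{(2)}\mathbf e_2$ with $z^{(1)},z^{(2)}\in\mathbb R$; addition and multiplication are component-wise in these coordinates, and $1=\mathbf e_1+\mathbf e_2$. Partial order: $z\preceq_{\mathbb D}w$ iff $z^{(1)}\le w^{(1)}$ and $z^{(2)}\le w^{(2)}$. $\mathbb D^{+}=\{z: 0\preceq_{\mathbb D}z\}$ and $[0,1]_{\mathbb D}=\{z: 0\preceq_{\mathbb D}z\preceq_{\mathbb D}1\}$. Distributions: $\mathcal P_{\mathbb D}(n)$ is the set of $P=(p_1,\ldots,p_n)\in\mathbb D^n$ with all $p_j\in[0,1]_{\mathbb D}$ and $s(P):=\sum_j p_j\in\{1,\mathbf e_1,\mathbf e_2\}$. Write $p_j=p_j^{(1)}\mathbf e_1+p_j^{(2)}\mathbf e_2$, $s^{(\ell)}(P)=\sum_j p_j^{(\ell)}\in\{0,1\}$. Component $\ell$ of $P$ is active if $s^{(\ell)}(P)=1$ and inactive if $s^{(\ell)}(P)=0$. Generators: a map $\Phi=\Phi^{(1)}\mathbf e_1+\Phi^{(2)}\mathbf e_2:[0,1]_{\mathbb D}\to\mathbb D^{+}$ is an admissible hyperbolic generator (for the given $n$) if (i) $z\preceq_{\mathbb D}w$ implies $\Phi(w)\preceq_{\mathbb D}\Phi(z)$,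 and (ii) for every $P\in\mathcal P_{\mathbb D}(n)$ and every active component $\ell$ of $P$, $Z_\ell^\Phi(P):=\sum_{j=1}^n\Phi^{(\ell)}(p_j)>0$. The generated negator is $\mathcal N_\Phi(P)=(q_1,\ldots,q_n)$ with $q_j^{(\ell)}=\Phi^{(\ell)}(p_j)/Z_\ell^\Phi(P)$ if component $\ell$ of $P$ is active, and $q_j^{(\ell)}=0$ if it is inactive. Entropies (with $0\log 0=0$): the strong hyperbolic Shannon entropy is $H_{\mathbb D}(P)=\sum_{\ell=1}^2\left(-\sum_{j=1}^n p_j^{(\ell)}\log p_j^{(\ell)}\right)\mathbf e_\ell$; the hyperbolic Gini--Simpson entropy is $G_{\mathbb D}(P)=\sum_{\ell=1}^2\left(s^{(\ell)}(P)-\sum_{j=1}^n (p_j^{(\ell)})^2\right)\mathbf e_\ell$. *)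

theory Defs
  imports "HOL-Analysis.Analysis"
begin

text \<open>\<open>Hyp a b\<close> is the hyperbolic number \<open>a + k b\<close> with \<open>k\<^sup>2 = 1\<close>.\<close>

datatype hyp = Hyp (hre: real) (him: real)

lemma hyp_eq_iff: "z = w \<longleftrightarrow> hre z = hre w \<and> him z = him w"
  by (cases z; cases w) simp

text \<open>The coordinates of \<open>a + k b\<close> with respect to \<open>e\<^sub>1 = (1 + k)/2\<close> and \<open>e\<^sub>2 = (1 - k)/2\<close>
  are \<open>a + b\<close> and \<open>a - b\<close>; see \<open>hyp_decomp\<close> and \<open>hyp_decomp_unique\<close> below.
  Only the indices \<open>1\<close> and \<open>2\<close> are meaningful.\<close>

definition hcomp :: "nat \<Rightarrow> hyp \<Rightarrow> real" where
  "hcomp l z = (if l = 1 then hre z + him z else hre z - him z)"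

instantiation hyp :: comm_ring_1
begin

definition zero_hyp :: hyp where "0 = Hyp 0 0"
definition one_hyp :: hyp where "1 = Hyp 1 0"
definition plus_hyp :: "hyp \<Rightarrow> hyp \<Rightarrow> hyp" where
  "z + w = Hyp (hre z + hre w) (him z + him w)"
definition uminus_hyp :: "hyp \<Rightarrow> hyp" where
  "- z = Hyp (- hre z) (- him z)"
definition minus_hyp :: "hyp \<Rightarrow> hyp \<Rightarrow> hyp" where
  "z - w = Hyp (hre z - hre w) (him z - him w)"
definition times_hyp :: "hyp \<Rightarrow> hyp \<Rightarrow> hyp" where
  "z * w = Hyp (hre z * hre w + him z * him w) (hre z * him w + him z * hre w)"

instance
  by standard
    (simp_all add: zero_hyp_def one_hyp_def plus_hyp_def uminus_hyp_def minus_hyp_def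
      times_hyp_def hyp_eq_iff algebra_simps)

end

instantiation hyp :: real_algebra_1
begin

definition scaleR_hyp :: "real \<Rightarrow> hyp \<Rightarrow> hyp" where
  "r *\<^sub>R z = Hyp (r * hre z) (r * him z)"

instance
  by standard
    (simp_all add: scaleR_hyp_def plus_hyp_def times_hyp_def hyp_eq_iff algebra_simps)

end

instantiation hyp :: order
begin

definition less_eq_hyp :: "hyp \<Rightarrow> hyp \<Rightarrow> bool" where
  "z \<le> w \<longleftrightarrow> (\<forall>l\<in>{1,2}. hcomp l z \<le> hcomp l w)"
definition less_hyp :: "hyp \<Rightarrow> hyp \<Rightarrow> bool" where
  "z < w \<longleftrightarrow> z \<le> w \<and> \<not> w \<le> (z::hyp)"

instance
  by standard (auto simp: less_eq_hyp_def less_hyp_def hcomp_def hyp_eq_iff)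

end

definition hyp_k :: hyp where
  "hyp_k = Hyp 0 1"

definition hyp_e :: "nat \<Rightarrow> hyp" where
  "hyp_e l = (if l = 1 then (1 + hyp_k) /\<^sub>R 2 else (1 - hyp_k) /\<^sub>R 2)"

lemmas hyp_defs = zero_hyp_def one_hyp_def plus_hyp_def uminus_hyp_def minus_hyp_def
  times_hyp_def scaleR_hyp_def hyp_k_def hyp_e_def hcomp_def

lemma hyp_k_square: "hyp_k * hyp_k = 1"
  by (simp add: hyp_defs)

lemma Hyp_eq: "Hyp a b = of_real a + hyp_k * of_real b"
  by (simp add: hyp_defs of_real_def)

lemma hyp_decomp: "z = hcomp 1 z *\<^sub>R hyp_e 1 + hcomp 2 z *\<^sub>R hyp_e 2"
  by (simp add: hyp_defs hyp_eq_iff field_simps)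

lemma hyp_decomp_unique:
  assumes "z = a *\<^sub>R hyp_e 1 + b *\<^sub>R hyp_e 2"
  shows "a = hcomp 1 z" "b = hcomp 2 z"
  using assms by (simp_all add: hyp_defs field_simps)

lemma hcomp_zero [simp]: "hcomp l 0 = 0"
  and hcomp_one [simp]: "hcomp l 1 = 1"
  and hcomp_add [simp]: "hcomp l (z + w) = hcomp l z + hcomp l w"
  and hcomp_mult [simp]: "hcomp l (z * w) = hcomp l z * hcomp l w"
  and hcomp_scaleR [simp]: "hcomp l (r *\<^sub>R z) = r * hcomp l z"
  by (simp_all add: hyp_defs algebra_simps)

lemma hcomp_sum [simp]: "hcomp l (sum f A) = (\<Sum>j\<in>A. hcomp l (f j))"
  by (induction A rule: infinite_finite_induct) auto

lemma hcomp_hyp_e: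
  "hcomp 1 (hyp_e 1) = 1" "hcomp 2 (hyp_e 1) = 0"
  "hcomp 1 (hyp_e 2) = 0" "hcomp 2 (hyp_e 2) = 1"
  by (simp_all add: hyp_defs)

lemma hyp_eqI: "hcomp 1 z = hcomp 1 w \<Longrightarrow> hcomp 2 z = hcomp 2 w \<Longrightarrow> z = w"
  by (metis hyp_decomp)

definition hyp_total :: "hyp ^ 'n \<Rightarrow> hyp" where
  "hyp_total P = (\<Sum>j\<in>UNIV. P $ j)"

definition hyp_dists :: "(hyp ^ 'n) set" where
  "hyp_dists = {P. (\<forall>j. P $ j \<in> {0..1}) \<and> hyp_total P \<in> {1, hyp_e 1, hyp_e 2}}"

definition active :: "nat \<Rightarrow> hyp ^ 'n \<Rightarrow> bool" where
  "active l P \<longleftrightarrow> hcomp l (hyp_total P) = 1"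

definition gen_sum :: "(hyp \<Rightarrow> hyp) \<Rightarrow> nat \<Rightarrow> hyp ^ 'n \<Rightarrow> real" where
  "gen_sum \<Phi> l P = (\<Sum>j\<in>UNIV. hcomp l (\<Phi> (P $ j)))"

text \<open>Admissibility depends on the number \<open>n\<close> of outcomes, which is the cardinality of the
  index type \<open>'n\<close>; hence the type argument.\<close>

definition admissible_generator :: "'n::finite itself \<Rightarrow> (hyp \<Rightarrow> hyp) \<Rightarrow> bool" where
  "admissible_generator (_ :: 'n itself) \<Phi> \<longleftrightarrow>
     \<Phi> \<in> {0..1} \<rightarrow> {0..} \<and>
     (\<forall>z\<in>{0..1}. \<forall>w\<in>{0..1}. z \<le> w \<longrightarrow> \<Phi> w \<le> \<Phi> z) \<and>
     (\<forall>P \<in> (hyp_dists :: (hyp ^ 'n) set). \<forall>l\<in>{1,2}. active l P \<longrightarrow> gen_sum \<Phi> l P > 0)"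

definition negator :: "(hyp \<Rightarrow> hyp) \<Rightarrow> hyp ^ 'n \<Rightarrow> hyp ^ 'n" where
  "negator \<Phi> P = (\<chi> j. \<Sum>l\<in>{1,2}.
     (if active l P then hcomp l (\<Phi> (P $ j)) / gen_sum \<Phi> l P else 0) *\<^sub>R hyp_e l)"

text \<open>The convention \<open>0 log 0 = 0\<close> is automatic, since the logarithm is multiplied by \<open>0\<close>.\<close>

definition shannon :: "hyp ^ 'n \<Rightarrow> hyp" where
  "shannon P = (\<Sum>l\<in>{1,2}. (- (\<Sum>j\<in>UNIV. hcomp l (P $ j) * ln (hcomp l (P $ j)))) *\<^sub>R hyp_e l)"

definition gini_simpson :: "hyp ^ 'n \<Rightarrow> hyp" where
  "gini_simpson P =
     (\<Sum>l\<in>{1,2}. (hcomp l (hyp_total P) - (\<Sum>j\<in>UNIV. (hcomp l (P $ j))\<^sup>2)) *\<^sub>R hyp_e l)"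

lemma hcomp_negator:
  assumes "l \<in> {1,2}"
  shows "hcomp l (negator \<Phi> P $ j) =
    (if active l P then hcomp l (\<Phi> (P $ j)) / gen_sum \<Phi> l P else 0)"
  using assms by (auto simp: negator_def hcomp_hyp_e hcomp_hyp_e[unfolded One_nat_def])

lemma negator_in_hyp_dists:
  fixes P :: "hyp ^ 'n"
  assumes adm: "admissible_generator TYPE('n) \<Phi>" and P: "P \<in> hyp_dists"
  shows "negator \<Phi> P \<in> hyp_dists"
proof -
  have nonneg: "hcomp l (\<Phi> (P $ j)) \<ge> 0" if "l \<in> {1,2}" for l j
  proof -
    have "\<Phi> (P $ j) \<ge> 0"
      using adm P by (auto simp: admissible_generator_def hyp_dists_def Pi_iff)
    then show ?thesis
      using that by (auto simp: less_eq_hyp_def)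
  qed
  have pos: "gen_sum \<Phi> l P > 0" if "l \<in> {1,2}" "active l P" for l
    using adm P that by (auto simp: admissible_generator_def)
  have le: "hcomp l (\<Phi> (P $ j)) \<le> gen_sum \<Phi> l P" if "l \<in> {1,2}" for l j
    unfolding gen_sum_def by (rule member_le_sum) (use nonneg that in auto)
  have tot: "hyp_total P \<in> {1, hyp_e 1, hyp_e 2}"
    using P by (simp add: hyp_dists_def)
  have "hcomp l (hyp_total (negator \<Phi> P)) = hcomp l (hyp_total P)" if l: "l \<in> {1,2}" for l
  proof (cases "active l P")
    case True
    have "hcomp l (hyp_total (negator \<Phi> P)) = (\<Sum>j\<in>UNIV. hcomp l (\<Phi> (P $ j)) / gen_sum \<Phi> l P)"
      using True by (simp add: hyp_total_def hcomp_negator[OF l])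
    also have "\<dots> = gen_sum \<Phi> l P / gen_sum \<Phi> l P"
      by (simp only: gen_sum_def sum_divide_distrib)
    finally show ?thesis
      using pos[OF l True] True by (simp add: active_def)
  next
    case False
    then have "hcomp l (hyp_total P) = 0"
      using tot l by (auto simp: active_def hcomp_hyp_e hcomp_hyp_e[unfolded One_nat_def])
    then show ?thesis
      using False by (simp add: hyp_total_def hcomp_negator[OF l])
  qed
  then have "hyp_total (negator \<Phi> P) = hyp_total P"
    by (intro hyp_eqI) auto
  moreover have "negator \<Phi> P $ j \<in> {0..1}" for j
    unfolding atLeastAtMost_iff less_eq_hyp_def
    using nonneg le pos by (auto simp: hcomp_negator divide_le_eq_1 less_imp_le)
  ultimately show ?thesis
    using tot by (simp add: hyp_dists_def)
qed

end

theory Submission imports Defs begin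

text \<open>In each active component, let \<open>p\<close> be the given distribution, \<open>q\<close> its negation, and
  \<open>y\<^sub>i = (1 - p\<^sub>i) / (n - 1)\<close> Yager's negation. Both \<open>y\<close> and \<open>q\<close> decrease as \<open>p\<close> increases,
  while \<open>q / y\<close> increases with \<open>p\<close>; so \<open>y - q\<close> changes sign only once along the order of \<open>q\<close>,
  which makes \<open>q\<close> majorized by \<open>y\<close>. Moreover \<open>y\<^sub>i\<close> is the mean of the \<open>p\<^sub>j\<close> with \<open>j \<noteq> i\<close>, which makes
  \<open>y\<close> majorized by \<open>p\<close>. Both steps are carried out for sums of a convex \<open>f\<close> given by its tangents,
  and applied to \<open>f x = x ln x\<close> and \<open>f x = x\<^sup>2\<close>.\<close>

text \<open>Since \<open>d\<close> sums to zero, \<open>g\<close> may be shifted by a constant.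
  Shifting by the maximum of \<open>g\<close> over the indices with \<open>d i < 0\<close> makes
  every summand nonnegative.\<close>

lemma sum_mult_nonneg_if_ordered_by_sign:
  fixes d g :: "'a \<Rightarrow> real"
  assumes "finite A" and "sum d A = 0"
    and ord: "\<And>i j. i \<in> A \<Longrightarrow> j \<in> A \<Longrightarrow> d i < 0 \<Longrightarrow> d j > 0 \<Longrightarrow> g i \<le> g j"
  shows "0 \<le> (\<Sum>i\<in>A. g i * d i)"
proof (cases "{i\<in>A. d i < 0} = {}")
  case True
  then have "\<forall>i\<in>A. d i = 0"
    using assms(1,2) by (subst sum_nonneg_eq_0_iff[symmetric]) (auto simp: not_less)
  then show ?thesis by simp
next
  case False
  define c where "c = Max (g ` {i\<in>A. d i < 0})"
  have "c \<in> g ` {i\<in>A. d i < 0}"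
    unfolding c_def using False assms(1) by (intro Max_in) auto
  then obtain k where k: "k \<in> A" "d k < 0" "c = g k" by auto
  have upper: "g i \<le> c" if "i \<in> A" "d i < 0" for i
    unfolding c_def using that assms(1) by (intro Max_ge) auto
  have "0 \<le> (g i - c) * d i" if "i \<in> A" for i
  proof (cases "d i" "0::real" rule: linorder_cases)
    case less
    then show ?thesis using upper[OF that] by (simp add: mult_nonpos_nonpos)
  next
    case greater
    then show ?thesis using ord[OF k(1) that k(2)] k(3) by simp
  qed simp
  then have "0 \<le> (\<Sum>i\<in>A. (g i - c) * d i)"
    by (intro sum_nonneg) auto
  also have "\<dots> = (\<Sum>i\<in>A. g i * d i) - c * sum d A"
    by (simp add: left_diff_distrib sum_subtractf sum_distrib_left)
  finally show ?thesis using assms(2) by simp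
qed

text \<open>Jensen's inequality for the mean of the \<open>p j\<close> with
  \<open>j \<noteq> i\<close>, summed over \<open>i\<close>. The slope \<open>g\<close> is required
  only at positive points, because \<open>x * ln x\<close> has no finite tangent at 0.\<close>

lemma sum_yager_negation_le:
  fixes p :: "'a \<Rightarrow> real" and f g :: "real \<Rightarrow> real"
  assumes fin: "finite A" and card: "card A \<ge> 2"
    and tangent: "\<And>x y. 0 < x \<Longrightarrow> x \<le> 1 \<Longrightarrow> 0 \<le> y \<Longrightarrow> y \<le> 1 \<Longrightarrow> f x + g x * (y - x) \<le> f y"
    and p: "\<And>i. i \<in> A \<Longrightarrow> 0 \<le> p i" "sum p A = 1"
  shows "(\<Sum>i\<in>A. f ((1 - p i) / real (card A - 1))) \<le> (\<Sum>i\<in>A. f (p i))"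
proof -
  define m where "m = real (card A - 1)"
  have m: "m \<ge> 1" "real (card A) = m + 1" using card by (auto simp: m_def of_nat_diff)
  have p1: "p i \<le> 1" if "i \<in> A" for i
    using member_le_sum[of i A p] fin p that by auto
  have rest: "sum h (A - {i}) = sum h A - h i" if "i \<in> A"  for i and h :: "'a \<Rightarrow> real"
    using fin that by (simp add: sum_diff1)
  have jensen: "m * f ((1 - p i) / m) \<le> sum (\<lambda>j. f (p j)) A - f (p i)" if i: "i \<in> A" for i
  proof -
    define y where "y = (1 - p i) / m"
    have y: "0 \<le> y" "y \<le> 1" "m * y = 1 - p i"
      using p1[OF i] p(1)[OF i] m by (auto simp: y_def field_simps)
    have cardrest: "real (card (A - {i})) = m" using i fin by (simp add: m_def)
    have "m * f y \<le> (\<Sum>j\<in>A-{i}. f (p j))"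
    \<comment> \<open>A mean of 0 forces all remaining \<open>p j\<close> to be 0, so no tangent at
      0 is needed; otherwise the tangents at \<open>y\<close> are summed and their linear parts
      cancel.\<close>
    proof (cases "y = 0")
      case True
      then have "sum p (A - {i}) = 0" using y(3) p(2) rest[OF i, of p] by simp
      then have "\<forall>j\<in>A-{i}. p j = 0"
        using fin p(1) by (subst (asm) sum_nonneg_eq_0_iff) auto
      then have "(\<Sum>j\<in>A-{i}. f (p j)) = (\<Sum>j\<in>A-{i}. f 0)" by (intro sum.cong) auto
      then show ?thesis using True cardrest by simp
    next
      case False
      have "(\<Sum>j\<in>A-{i}. f y + g y * (p j - y)) = m * f y + g y * (sum p (A-{i}) - m * y)"
        unfolding sum.distrib sum_distrib_left[symmetric] sum_subtractf sum_constant cardrest ..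
      also have "\<dots> = m * f y" using y(3) p(2) rest[OF i, of p] by simp
      finally have "m * f y = (\<Sum>j\<in>A-{i}. f y + g y * (p j - y))" by simp
      also have "\<dots> \<le> (\<Sum>j\<in>A-{i}. f (p j))"
        using False y p(1) p1 by (intro sum_mono tangent) auto
      finally show ?thesis .
    qed
    then show ?thesis using rest[OF i, of "\<lambda>j. f (p j)"] by (simp add: y_def)
  qed
  have "m * (\<Sum>i\<in>A. f ((1 - p i) / m)) \<le> (\<Sum>i\<in>A. sum (\<lambda>j. f (p j)) A - f (p i))"
    unfolding sum_distrib_left by (intro sum_mono jensen)
  \<comment> \<open>Each \<open>f (p j)\<close> is counted once for every
    \<open>i \<noteq> j\<close>, that is, \<open>m\<close> times.\<close>
  also have "\<dots> = m * (\<Sum>i\<in>A. f (p i))"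
    using m by (simp add: sum_subtractf algebra_simps)
  finally show ?thesis using m(1) unfolding m_def[symmetric] by simp
qed

text \<open>The tangents of \<open>f\<close> at \<open>q i\<close> bound the gain from
  \<open>q\<close> to \<open>y\<close> below by the sum of \<open>g (q i) * (y i - q i)\<close>,
  which is nonnegative by the sign lemma with \<open>d = y - q\<close>. The step from
  \<open>y\<close> to \<open>p\<close> is the preceding lemma.\<close>

lemma sum_negation_le:
  fixes p \<phi> :: "'a \<Rightarrow> real" and f g :: "real \<Rightarrow> real"
  assumes fin: "finite A" and card: "card A \<ge> 2"
    and tangent: "\<And>x y. 0 < x \<Longrightarrow> x \<le> 1 \<Longrightarrow> 0 \<le> y \<Longrightarrow> y \<le> 1 \<Longrightarrow> f x + g x * (y - x) \<le> f y"
    and p: "\<And>i. i \<in> A \<Longrightarrow> 0 \<le> p i" "sum p A = 1"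
    and \<phi>: "\<And>i. i \<in> A \<Longrightarrow> 0 \<le> \<phi> i" "sum \<phi> A > 0"
    and one: "\<And>i. i \<in> A \<Longrightarrow> p i = 1 \<Longrightarrow> \<phi> i = 0"
    and anti: "\<And>i j. i \<in> A \<Longrightarrow> j \<in> A \<Longrightarrow> p i \<le> p j \<Longrightarrow> p j < 1 \<Longrightarrow> \<phi> j \<le> \<phi> i"
    and ratio: "\<And>i j. i \<in> A \<Longrightarrow> j \<in> A \<Longrightarrow> p i \<le> p j \<Longrightarrow> p j < 1 \<Longrightarrow>
                  \<phi> i / (1 - p i) \<le> \<phi> j / (1 - p j)"
  shows "(\<Sum>i\<in>A. f (\<phi> i / sum \<phi> A)) \<le> (\<Sum>i\<in>A. f (p i))"
proof -
  define m where "m = real (card A - 1)"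
  define y where "y = (\<lambda>i. (1 - p i) / m)"
  define Z where "Z = sum \<phi> A"
  define q where "q = (\<lambda>i. \<phi> i / Z)"
  have m: "m \<ge> 1" "real (card A) = m + 1" using card by (auto simp: m_def of_nat_diff)
  have Z: "Z > 0" using \<phi>(2) by (simp add: Z_def)
  have p1: "p i \<le> 1" if "i \<in> A" for i
    using member_le_sum[of i A p] fin p that by auto
  have q: "0 \<le> q i" "q i \<le> 1" if "i \<in> A" for i
    using member_le_sum[of i A \<phi>] fin \<phi> Z that by (auto simp: q_def Z_def)
  have y: "0 \<le> y i" "y i \<le> 1" if "i \<in> A" for i
    using p1[OF that] p(1)[OF that] m by (auto simp: y_def field_simps)
  have "sum y A = (real (card A) - sum p A) / m"
    by (simp add: y_def sum_subtractf flip: sum_divide_distrib)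
  then have sumy: "sum y A = 1" using m p(2) by simp
  have sumq: "sum q A = 1" using Z by (simp add: q_def Z_def flip: sum_divide_distrib)
  have lt1: "p i < 1" if "i \<in> A" "q i \<noteq> 0 \<or> y i \<noteq> 0" for i
    using one[of i] p1[of i] that by (auto simp: q_def y_def less_le)
  \<comment> \<open>Needed for a tangent at \<open>q i\<close>. A zero of \<open>\<phi>\<close> at
    \<open>i\<close> would spread to larger \<open>p j < 1\<close> by \<open>anti\<close>, to
    smaller ones by \<open>ratio\<close>, and to \<open>p j = 1\<close> by \<open>one\<close>,
    against the positive sum.\<close>
  have qpos: "0 < q i" if i: "i \<in> A" and pi: "p i < 1" for i
  proof (rule ccontr)
    assume "\<not> 0 < q i"
    then have "\<phi> i = 0" using \<phi>(1)[OF i] Z by (simp add: q_def zero_less_divide_iff)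
    have "\<phi> j = 0" if j: "j \<in> A" for j
    proof (cases "p j < 1")
      case True
      show ?thesis
      proof (cases "p i \<le> p j")
        case True
        then show ?thesis using anti[OF i j] \<open>p j < 1\<close> \<open>\<phi> i = 0\<close> \<phi>(1)[OF j] by simp
      next
        case False
        then have "\<phi> j / (1 - p j) \<le> 0" using ratio[OF j i] pi \<open>\<phi> i = 0\<close> by simp
        then show ?thesis using True \<phi>(1)[OF j] by (simp add: divide_le_0_iff)
      qed
    next
      case False
      then show ?thesis using one[OF j] p1[OF j] by simp
    qed
    then show False using \<phi>(2) by simp
  qed
  \<comment> \<open>Adding the tangent inequalities from \<open>a\<close> to \<open>b\<close> and
    from \<open>b\<close> to \<open>a\<close> shows that slopes increase.\<close>
  have mono: "g a \<le> g b" if "0 < a" "a \<le> b" "b \<le> 1" for a b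
  proof (cases "a = b")
    case False
    then have "g a * (b - a) \<le> g b * (b - a)"
      using tangent[of a b] tangent[of b a] that by (simp add: algebra_simps)
    then show ?thesis using False that by simp
  qed simp
  have "0 \<le> (\<Sum>i\<in>A. g (q i) * (y i - q i))"
  proof (rule sum_mult_nonneg_if_ordered_by_sign[OF fin])
    show "(\<Sum>i\<in>A. y i - q i) = 0" by (simp add: sum_subtractf sumy sumq)
    fix i j assume i: "i \<in> A" and j: "j \<in> A" and ij: "y i - q i < 0" "y j - q j > 0"
    have pi: "p i < 1" using lt1[OF i] ij(1) y(1)[OF i] by linarith
    have pj: "p j < 1" using lt1[OF j] ij(2) q(1)[OF j] by linarith
    \<comment> \<open>The signs of \<open>y - q\<close> place \<open>\<phi> / (1 - p)\<close> above
      \<open>Z / m\<close> at \<open>i\<close> and below it at \<open>j\<close>, whereas this ratio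
      grows with \<open>p\<close>.\<close>
    have "\<not> p i \<le> p j"
    proof
      assume "p i \<le> p j"
      have "m * \<phi> j < Z * (1 - p j)" "Z * (1 - p i) < m * \<phi> i"
        using ij m Z by (auto simp: q_def y_def field_simps)
      then have "\<phi> j / (1 - p j) < Z / m" "Z / m < \<phi> i / (1 - p i)"
        using pi pj m by (auto simp: field_simps)
      then show False using ratio[OF i j \<open>p i \<le> p j\<close> pj] by simp
    qed
    then have "q i \<le> q j"
      using anti[OF j i] pi Z by (simp add: q_def divide_right_mono)
    then show "g (q i) \<le> g (q j)" using qpos[OF i pi] q(2)[OF j] by (intro mono)
  qed
  also have "(\<Sum>i\<in>A. g (q i) * (y i - q i)) \<le> (\<Sum>i\<in>A. f (y i) - f (q i))"
  proof (rule sum_mono)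
    fix i assume i: "i \<in> A"
    show "g (q i) * (y i - q i) \<le> f (y i) - f (q i)"
    \<comment> \<open>At \<open>p i = 1\<close> both \<open>q i\<close> and \<open>y i\<close>
      vanish, so both sides are 0.\<close>
    proof (cases "p i < 1")
      case True
      then show ?thesis using tangent[of "q i" "y i"] qpos[OF i] q[OF i] y[OF i] by simp
    next
      case False
      then have "q i = 0" "y i = 0" using lt1[OF i] by auto
      then show ?thesis by simp
    qed
  qed
  finally have "(\<Sum>i\<in>A. f (q i)) \<le> (\<Sum>i\<in>A. f (y i))" by (simp add: sum_subtractf)
  also have "\<dots> \<le> (\<Sum>i\<in>A. f (p i))"
    unfolding y_def m_def
    by (rule sum_yager_negation_le[where f = f and g = g and p = p and A = A, OF fin card tangent p])
  finally show ?thesis by (simp add: q_def Z_def)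
qed

text \<open>For \<open>y > 0\<close> this rearranges to \<open>y * ln (x / y) \<le> x - y\<close>,
  an instance of \<open>ln t \<le> t - 1\<close>; for \<open>y = 0\<close> it reads
  \<open>- x \<le> 0\<close>.\<close>

lemma xlnx_tangent_le:
  fixes x y :: real
  assumes "0 < x" "0 \<le> y"
  shows "x * ln x + (ln x + 1) * (y - x) \<le> y * ln y"
proof (cases "y = 0")
  case False
  then have "y * ln (x / y) \<le> y * (x / y - 1)"
    using assms by (intro mult_left_mono ln_le_minus_one) auto
  then show ?thesis using False assms by (simp add: ln_div algebra_simps)
qed (use assms in \<open>simp add: algebra_simps\<close>)

lemma square_tangent_le: "x\<^sup>2 + 2 * x * (y - x) \<le> y\<^sup>2" for x y :: real
  using zero_le_power2[of "y - x"] by (simp add: power2_eq_square algebra_simps)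

lemma hcomp_uminus: "hcomp l (- z) = - hcomp l z"
  and hcomp_diff: "hcomp l (z - w) = hcomp l z - hcomp l w"
  by (simp_all add: hyp_defs)

lemma hcomp_shannon:
  "l \<in> {1,2} \<Longrightarrow> hcomp l (shannon P) = - (\<Sum>j\<in>UNIV. hcomp l (P $ j) * ln (hcomp l (P $ j)))"
  by (auto simp: shannon_def hcomp_uminus hcomp_diff hcomp_hyp_e hcomp_hyp_e[unfolded One_nat_def])

lemma hcomp_gini_simpson:
  "l \<in> {1,2} \<Longrightarrow>
    hcomp l (gini_simpson P) = (\<Sum>j\<in>UNIV. hcomp l (P $ j)) - (\<Sum>j\<in>UNIV. (hcomp l (P $ j))\<^sup>2)"
  by (auto simp: gini_simpson_def hyp_total_def hcomp_hyp_e hcomp_hyp_e[unfolded One_nat_def])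

theorem theorem5p4:
  fixes \<Phi> :: "hyp \<Rightarrow> hyp"
  assumes "CARD('n::finite) \<ge> 2"
    and "admissible_generator TYPE('n) \<Phi>"
    and "\<forall>P \<in> (hyp_dists :: (hyp ^ 'n) set). \<forall>l\<in>{1,2}. active l P \<longrightarrow> (\<forall>j.
           hcomp l (P $ j) = 1 \<longrightarrow> hcomp l (\<Phi> (P $ j)) = 0)"
    and "\<forall>P \<in> (hyp_dists :: (hyp ^ 'n) set). \<forall>l\<in>{1,2}. active l P \<longrightarrow> (\<forall>i j.
           hcomp l (P $ i) \<le> hcomp l (P $ j) \<and> hcomp l (P $ j) < 1 \<longrightarrow>
             hcomp l (\<Phi> (P $ i)) \<ge> hcomp l (\<Phi> (P $ j)) \<and>
             hcomp l (\<Phi> (P $ i)) / (1 - hcomp l (P $ i)) \<le>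
               hcomp l (\<Phi> (P $ j)) / (1 - hcomp l (P $ j)))"
  shows "\<forall>P \<in> (hyp_dists :: (hyp ^ 'n) set).
           shannon P \<le> shannon (negator \<Phi> P) \<and>
           gini_simpson P \<le> gini_simpson (negator \<Phi> P)"
proof
  fix P :: "hyp ^ 'n" assume P: "P \<in> hyp_dists"
  have "hcomp l (shannon P) \<le> hcomp l (shannon (negator \<Phi> P)) \<and>
        hcomp l (gini_simpson P) \<le> hcomp l (gini_simpson (negator \<Phi> P))" if l: "l \<in> {1,2}" for l
  proof -
    define p where "p = (\<lambda>j. hcomp l (P $ j))"
    define \<phi> where "\<phi> = (\<lambda>j. hcomp l (\<Phi> (P $ j)))"
    have p0: "0 \<le> p j" for j
      using P l by (auto simp: p_def hyp_dists_def less_eq_hyp_def)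
    have \<phi>0: "0 \<le> \<phi> j" for j
    proof -
      have "0 \<le> \<Phi> (P $ j)"
        using assms(2) P by (auto simp: admissible_generator_def hyp_dists_def Pi_iff)
      then show ?thesis using l by (auto simp: \<phi>_def less_eq_hyp_def)
    qed
    have tot: "hcomp l (hyp_total P) = sum p UNIV" by (simp add: p_def hyp_total_def)
    show ?thesis
    proof (cases "active l P")
      case True
      have sump: "sum p UNIV = 1" using True tot by (simp add: active_def)
      have gs: "gen_sum \<Phi> l P = sum \<phi> UNIV" by (simp add: gen_sum_def \<phi>_def)
      have pos: "sum \<phi> UNIV > 0"
        using assms(2) P l True by (auto simp: admissible_generator_def simp flip: gs)
      have neg: "hcomp l (negator \<Phi> P $ j) = \<phi> j / sum \<phi> UNIV" for j
        using True by (simp add: hcomp_negator[OF l] gs) (simp add: \<phi>_def)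
      have le: "(\<Sum>j\<in>UNIV. f (\<phi> j / sum \<phi> UNIV)) \<le> (\<Sum>j\<in>UNIV. f (p j))"
        if "\<And>x y. 0 < x \<Longrightarrow> x \<le> 1 \<Longrightarrow> 0 \<le> y \<Longrightarrow> y \<le> 1 \<Longrightarrow> f x + g x * (y - x) \<le> f y"
        for f g :: "real \<Rightarrow> real"
      proof (rule sum_negation_le[where f = f and g = g])
        show "p j = 1 \<Longrightarrow> \<phi> j = 0" for j
          using assms(3) P l True by (auto simp: p_def \<phi>_def)
        show "p i \<le> p j \<Longrightarrow> p j < 1 \<Longrightarrow> \<phi> j \<le> \<phi> i"
          and "p i \<le> p j \<Longrightarrow> p j < 1 \<Longrightarrow> \<phi> i / (1 - p i) \<le> \<phi> j / (1 - p j)" for i j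
          using assms(4) P l True by (auto simp: p_def \<phi>_def)
      qed (use assms(1) that p0 sump \<phi>0 pos in auto)
      \<comment> \<open>Equal masses cancel in the Gini-Simpson comparison, leaving only the sums of
        squares.\<close>
      have "(\<Sum>j\<in>UNIV. \<phi> j / sum \<phi> UNIV) = sum p UNIV"
        using pos sump by (simp flip: sum_divide_distrib)
      then show ?thesis
        using le[of "\<lambda>x. x * ln x" "\<lambda>x. ln x + 1", OF xlnx_tangent_le] le[of "\<lambda>x. x\<^sup>2" "\<lambda>x. 2 * x", OF square_tangent_le]
        by (simp add: hcomp_shannon[OF l] hcomp_gini_simpson[OF l] neg p_def)
    next
      \<comment> \<open>An inactive component has total 0, so its nonnegative coordinates all
        vanish, as do those of the negator by definition; both entropies are 0 there.\<close>
      case False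
      then have "sum p UNIV = 0"
        using P l by (auto simp: active_def hyp_dists_def hcomp_hyp_e
            hcomp_hyp_e[unfolded One_nat_def] simp flip: tot)
      then have "hcomp l (P $ j) = 0" for j
        using p0 by (simp add: sum_nonneg_eq_0_iff p_def)
      then show ?thesis
        using False by (simp add: hcomp_shannon[OF l] hcomp_gini_simpson[OF l] hcomp_negator[OF l])
    qed
  qed
  then show "shannon P \<le> shannon (negator \<Phi> P) \<and> gini_simpson P \<le> gini_simpson (negator \<Phi> P)"
    by (auto simp: less_eq_hyp_def)
qed

end
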